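(* As $m \to + \infty$, $$\mathsf{D}^{(4)} (\mathcal{B}^{(3)}_m) \sim \frac{16}{3 \sqrt 3} m^3,$$ i.e. the ratio of the two sides tends to $1$.
   Context: A sequence over a subset $X$ of an abelian group is a finite unordered sequence (multiset) of elements of $X$; its support is the set of distinct elements occurring in it. It is a minimal zero-sum sequence if its terms sum to $0$ and no non-empty proper subsequence sums to $0$. $\mathsf{D}^{(k)}(X)$ denotes the largest length of a minimal zero-sum sequence over $X$ whose support has exactly $k$ elements. $\mathcal{B}^{(3)}_m=\{(u_1,u_2,u_3)\in\mathbb{Z}^3 : u_1^2+u_2^2+u_3^2\le m^2\}$. *)

theory Defs
  imports
    "HOL-Analysis.Analysis"
    "HOL-Library.Multiset"
    "HOL-Library.Landau_Symbols"
begin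

definition minimal_zero_sum :: "'a::ab_group_add multiset \<Rightarrow> bool" where
  "minimal_zero_sum S \<longleftrightarrow>
     sum_mset S = 0 \<and> (\<forall>T. T \<subset># S \<longrightarrow> T \<noteq> {#} \<longrightarrow> sum_mset T \<noteq> 0)"

text \<open>
  The largest length of a minimal zero-sum sequence over \<open>X\<close> with exactly \<open>k\<close> distinct terms.
  The value is meaningful only if the set of such lengths is finite and non-empty;
  otherwise \<open>Max\<close> is unspecified.
\<close>
definition davenport_supp :: "nat \<Rightarrow> 'a::ab_group_add set \<Rightarrow> nat" where
  "davenport_supp k X =
     Max {size S | S. set_mset S \<subseteq> X \<and> card (set_mset S) = k \<and> minimal_zero_sum S}"

definition int_ball3 :: "real \<Rightarrow> (int ^ 3) set" where
  "int_ball3 m = {u. real_of_int ((u $ 1)\<^sup>2 + (u $ 2)\<^sup>2 + (u $ 3)\<^sup>2) \<le> m\<^sup>2}"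

end

theory Submission
  imports Defs "HOL-Real_Asymp.Real_Asymp"
begin

text \<open>
  Let \<open>S\<close> be a minimal zero-sum sequence with four distinct terms. If they span a space of dimension 3,
  the linear relation between them is unique up to scaling and, by Cramer's rule, given by the four
  \<open>3 \<times> 3\<close> determinants; by minimality the length of \<open>S\<close> is at most the sum of their absolute
  values, which is 6 times the volume of a simplex in the ball of radius \<open>m\<close> and therefore at most
  \<open>16 / (3 \<surd>3) m\<^sup>3\<close>. If they span a space of dimension at most 2, a Caratheodory argument
  decomposes the relation of \<open>S\<close> into boundedly many relations with coefficients \<open>O(m\<^sup>2)\<close>, so the
  length is \<open>O(m\<^sup>2)\<close>. For the lower bound, perturb a regular simplex so that its four determinants
  become coprime; then they are the multiplicities of a minimal zero-sum sequence.
\<close>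

section \<open>Linear relations and minimal zero-sum sequences\<close>

text \<open>Real coefficients allow the subtraction of real multiples of relations, as in
  Caratheodory's theorem.\<close>

definition linear_relation :: "(int ^ 'n) set \<Rightarrow> (int ^ 'n \<Rightarrow> real) \<Rightarrow> bool" where
  "linear_relation V f \<longleftrightarrow> (\<forall>i. (\<Sum>v\<in>V. f v * real_of_int (v $ i)) = 0)"

lemma sum_mset_component:
  fixes S :: "(int ^ 'n) multiset"
  assumes "finite V" "set_mset S \<subseteq> V"
  shows "sum_mset S $ i = (\<Sum>v\<in>V. int (count S v) * v $ i)"
  using assms(2)
proof (induction S)
  case empty
  then show ?case by simp
next
  case (add x S)
  have "(\<Sum>v\<in>V. int (count (add_mset x S) v) * v $ i)
      = (\<Sum>v\<in>V. int (count S v) * v $ i + (if v = x then v $ i else 0))"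
    by (intro sum.cong) (auto simp: algebra_simps)
  also have "\<dots> = (\<Sum>v\<in>V. int (count S v) * v $ i) + x $ i"
    using add.prems assms(1) by (simp add: sum.distrib sum.delta)
  finally show ?case using add by simp
qed

lemma sum_mset_eq_0_iff_linear_relation:
  fixes S :: "(int ^ 'n) multiset"
  assumes "finite V" "set_mset S \<subseteq> V"
  shows "sum_mset S = 0 \<longleftrightarrow> linear_relation V (\<lambda>v. real (count S v))"
proof -
  have "real_of_int (sum_mset S $ i) = (\<Sum>v\<in>V. real (count S v) * real_of_int (v $ i))" for i
    by (simp add: sum_mset_component[OF assms])
  then show ?thesis
    unfolding linear_relation_def vec_eq_iff by (metis of_int_eq_0_iff zero_index)
qed

text \<open>The numbers \<open>r v\<close> are the multiplicities of a non-empty zero-sum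
  subsequence of \<open>S\<close>, which minimality forces to be \<open>S\<close> itself.\<close>

lemma minimal_zero_sum_relation_unique:
  fixes S :: "(int ^ 'n) multiset" and r :: "int ^ 'n \<Rightarrow> nat"
  assumes S: "minimal_zero_sum S"
    and le: "\<And>v. v \<in> set_mset S \<Longrightarrow> r v \<le> count S v"
    and nz: "v\<^sub>0 \<in> set_mset S" "r v\<^sub>0 > 0"
    and rel: "linear_relation (set_mset S) (\<lambda>v. real (r v))"
    and v: "v \<in> set_mset S"
  shows "r v = count S v"
proof -
  define T where "T = (\<Sum>v\<in>set_mset S. replicate_mset (r v) v)"
  have count_T: "count T u = (if u \<in> set_mset S then r u else 0)" for u
    unfolding T_def by (simp add: count_sum)
  have sub: "T \<subseteq># S"
    using le by (auto simp: subseteq_mset_def count_T)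
  then have "set_mset T \<subseteq> set_mset S" by (rule set_mset_mono)
  then have "sum_mset T = 0"
    using rel by (simp add: sum_mset_eq_0_iff_linear_relation[where V = "set_mset S"]
        linear_relation_def count_T)
  moreover have "T \<noteq> {#}" using nz count_T[of v\<^sub>0] by auto
  ultimately have "T = S"
    using S sub unfolding minimal_zero_sum_def by (metis subset_mset.le_imp_less_or_eq)
  then show ?thesis using count_T[of v] v by simp
qed

section \<open>Short relations\<close>

text \<open>Caratheodory step: subtract the largest multiple of \<open>c\<close> that keeps all
  coefficients non-negative. A coefficient attaining the minimal ratio \<open>b v / c v\<close>
  becomes 0, and the support does not grow because \<open>c\<close> vanishes wherever
  \<open>b\<close> does.\<close>

lemma linear_relation_shrink_support:
  fixes b c :: "int ^ 'n \<Rightarrow> real"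
  assumes "finite V" and b: "linear_relation V b" "\<And>v. v \<in> V \<Longrightarrow> b v \<ge> 0"
    and c: "linear_relation V c" "\<And>v. v \<in> V \<Longrightarrow> b v = 0 \<Longrightarrow> c v = 0"
    and pos: "v\<^sub>0 \<in> V" "c v\<^sub>0 > 0"
  obtains t where "t > 0" "linear_relation V (\<lambda>v. b v - t * c v)"
    "\<And>v. v \<in> V \<Longrightarrow> b v - t * c v \<ge> 0"
    "card {v \<in> V. b v - t * c v > 0} < card {v \<in> V. b v > 0}"
proof -
  define P where "P = {v \<in> V. c v > 0}"
  have P: "finite P" "P \<noteq> {}" using assms by (auto simp: P_def)
  define t where "t = Min ((\<lambda>v. b v / c v) ` P)"
  have "t \<in> (\<lambda>v. b v / c v) ` P" unfolding t_def using P by (intro Min_in) auto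
  then obtain u where u: "u \<in> P" "t = b u / c u" by auto
  have bu: "b u > 0" using b(2)[of u] c(2)[of u] u by (force simp: P_def)
  have t0: "t > 0" using u bu by (simp add: P_def)
  have nonneg: "b v - t * c v \<ge> 0" if "v \<in> V" for v
  proof (cases "c v > 0")
    case True
    then have "t \<le> b v / c v" unfolding t_def using P that by (intro Min_le) (auto simp: P_def)
    then show ?thesis using True by (simp add: field_simps)
  next
    case False
    then have "t * c v \<le> 0" using t0 by (simp add: mult_nonneg_nonpos)
    then show ?thesis using b(2)[OF that] by simp
  qed
  have zero: "b u - t * c u = 0" using u by (simp add: P_def)
  have "{v \<in> V. b v - t * c v > 0} \<subseteq> {v \<in> V. b v > 0} - {u}"
    using zero b(2) c(2) by (force simp: order_le_less)
  moreover have "u \<in> {v \<in> V. b v > 0}" using bu u by (simp add: P_def)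
  ultimately have less: "card {v \<in> V. b v - t * c v > 0} < card {v \<in> V. b v > 0}"
    using \<open>finite V\<close> by (intro psubset_card_mono) auto
  have "linear_relation V (\<lambda>v. b v - t * c v)"
    using b(1) c(1) unfolding linear_relation_def
    by (simp add: left_diff_distrib sum_subtractf mult.assoc sum_distrib_left[symmetric])
  then show ?thesis using that t0 nonneg less by blast
qed

text \<open>Signs are repaired by induction on the support of \<open>b\<close>: if the short
  relation has coefficients of both signs, subtracting a multiple of it from \<open>b\<close>
  shrinks the support, and \<open>K\<close> is the same for every \<open>b\<close>.\<close>

lemma exists_short_nonneg_relation:
  fixes b :: "int ^ 'n \<Rightarrow> real"
  assumes "finite V"
    and short: "\<And>b. linear_relation V b \<Longrightarrow> (\<And>v. v \<in> V \<Longrightarrow> b v \<ge> 0) \<Longrightarrow> \<exists>v\<in>V. b v \<noteq> 0 \<Longrightarrow>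
      \<exists>c :: int ^ 'n \<Rightarrow> int. linear_relation V (\<lambda>v. real_of_int (c v))
        \<and> (\<forall>v\<in>V. b v = 0 \<longrightarrow> c v = 0) \<and> (\<exists>v\<in>V. c v \<noteq> 0)
        \<and> (\<forall>v\<in>V. \<bar>real_of_int (c v)\<bar> \<le> K)"
    and "linear_relation V b" "\<And>v. v \<in> V \<Longrightarrow> b v \<ge> 0" "\<exists>v\<in>V. b v \<noteq> 0"
  shows "\<exists>r :: int ^ 'n \<Rightarrow> nat. linear_relation V (\<lambda>v. real (r v))
        \<and> (\<forall>v\<in>V. b v = 0 \<longrightarrow> r v = 0) \<and> (\<exists>v\<in>V. r v > 0) \<and> (\<forall>v\<in>V. real (r v) \<le> K)"
  using assms(3-)
proof (induction "card {v \<in> V. b v > 0}" arbitrary: b rule: less_induct)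
  case less
  obtain c' :: "int ^ 'n \<Rightarrow> int" where c': "linear_relation V (\<lambda>v. real_of_int (c' v))"
    "\<forall>v\<in>V. b v = 0 \<longrightarrow> c' v = 0" "\<exists>v\<in>V. c' v \<noteq> 0" "\<forall>v\<in>V. \<bar>real_of_int (c' v)\<bar> \<le> K"
    using short[OF less.prems] by blast
  obtain c :: "int ^ 'n \<Rightarrow> int" and v\<^sub>0 where c: "linear_relation V (\<lambda>v. real_of_int (c v))"
    "\<And>v. v \<in> V \<Longrightarrow> b v = 0 \<Longrightarrow> c v = 0" "v\<^sub>0 \<in> V" "c v\<^sub>0 > 0"
    "\<And>v. v \<in> V \<Longrightarrow> \<bar>real_of_int (c v)\<bar> \<le> K"
  proof (cases "\<exists>v\<in>V. c' v > 0")
    case True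
    then show ?thesis using c' that[of c'] by blast
  next
    case False
    then obtain v where "v \<in> V" "c' v < 0" using c'(3) by (meson linorder_neqE)
    moreover have "linear_relation V (\<lambda>v. real_of_int (- c' v))"
      using c'(1) by (simp add: linear_relation_def sum_negf)
    ultimately show ?thesis using c' that[of "\<lambda>v. - c' v" v] by simp
  qed
  show ?case
  proof (cases "\<forall>v\<in>V. c v \<ge> 0")
    case True
    have "linear_relation V (\<lambda>v. real (nat (c v)))"
      using c(1) True by (simp add: linear_relation_def)
    moreover have "\<forall>v\<in>V. real (nat (c v)) \<le> K" using c(5) True by fastforce
    ultimately show ?thesis using c(2-4) by (intro exI[of _ "\<lambda>v. nat (c v)"]) auto
  next
    case False
    then obtain w where w: "w \<in> V" "c w < 0" by force
    obtain t :: real where t: "t > 0" "linear_relation V (\<lambda>v. b v - t * c v)"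
      "\<And>v. v \<in> V \<Longrightarrow> b v - t * c v \<ge> 0"
      "card {v \<in> V. b v - t * c v > 0} < card {v \<in> V. b v > 0}"
      using linear_relation_shrink_support[OF \<open>finite V\<close> less.prems(1,2) c(1) _ c(3)] c(2,4)
      by simp blast
    \<comment> \<open>The negative coefficient at \<open>w\<close> keeps the reduced relation from
      vanishing, so the induction hypothesis applies.\<close>
    have "b w - t * c w > 0" using less.prems(2)[OF w(1)] t(1) w(2)
      by (smt (verit) mult_pos_neg of_int_less_0_iff)
    then have "\<exists>v\<in>V. b v - t * c v \<noteq> 0" using w(1) by force
    from less.hyps[OF t(4,2,3) this] obtain r :: "int ^ 'n \<Rightarrow> nat" where
      r: "linear_relation V (\<lambda>v. real (r v))" "\<forall>v\<in>V. b v - t * c v = 0 \<longrightarrow> r v = 0"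
      "\<exists>v\<in>V. r v > 0" "\<forall>v\<in>V. real (r v) \<le> K" by auto
    then show ?thesis using c(2) by (intro exI[of _ r]) auto
  qed
qed

text \<open>A relation below a minimal one is a sum of boundedly many short relations whose
  coefficients are less than 1, unless the minimal one is itself short.\<close>

lemma minimal_zero_sum_size_le_short:
  fixes S :: "(int ^ 'n) multiset"
  assumes S: "minimal_zero_sum S" and "K \<ge> 0"
    and short: "\<And>b. linear_relation (set_mset S) b \<Longrightarrow> (\<And>v. v \<in># S \<Longrightarrow> b v \<ge> 0) \<Longrightarrow>
      \<exists>v\<in>#S. b v \<noteq> 0 \<Longrightarrow>
      \<exists>r :: int ^ 'n \<Rightarrow> nat. linear_relation (set_mset S) (\<lambda>v. real (r v))
        \<and> (\<forall>v\<in>#S. b v = 0 \<longrightarrow> r v = 0) \<and> (\<exists>v\<in>#S. r v > 0) \<and> (\<forall>v\<in>#S. real (r v) \<le> K)"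
  shows "real (size S) \<le> (real (card (set_mset S)))\<^sup>2 * K"
proof -
  define V where "V = set_mset S"
  define k where "k = real (card V) * K"
  have V: "finite V" and k: "k \<ge> 0" using \<open>K \<ge> 0\<close> by (auto simp: V_def k_def)
  have size: "real (size S) = (\<Sum>v\<in>V. real (count S v))"
    by (simp add: size_multiset_overloaded_eq V_def)
  \<comment> \<open>The claim covers real \<open>b\<close> because the remainders
    \<open>b v - t * r v\<close> need not be integral. For \<open>t < 1\<close> each removal takes
    away a sum of at most \<open>k\<close> and at least one element of the support.\<close>
  have main: "(\<Sum>v\<in>V. b v) \<le> card {v \<in> V. b v > 0} * k"
    if "linear_relation V b" "\<And>v. v \<in> V \<Longrightarrow> b v \<ge> 0" "\<And>v. v \<in> V \<Longrightarrow> b v \<le> real (count S v)" for b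
    using that
  proof (induction "card {v \<in> V. b v > 0}" arbitrary: b rule: less_induct)
    case less
    show ?case
    proof (cases "\<exists>v\<in>V. b v \<noteq> 0")
      case False
      then show ?thesis using k by simp
    next
      case True
      obtain r v\<^sub>0 where r: "linear_relation V (\<lambda>v. real (r v))"
        "\<And>v. v \<in> V \<Longrightarrow> b v = 0 \<Longrightarrow> r v = 0" "v\<^sub>0 \<in> V" "r v\<^sub>0 > 0"
        "\<And>v. v \<in> V \<Longrightarrow> real (r v) \<le> K"
        using short[of b] less.prems(1,2) True by (auto simp: V_def)
      have sum_r: "(\<Sum>v\<in>V. real (r v)) \<le> k"
        using sum_bounded_above[of V "\<lambda>v. real (r v)" K] r(5) by (simp add: k_def)
      obtain t :: real where t: "t > 0" "linear_relation V (\<lambda>v. b v - t * r v)"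
        "\<And>v. v \<in> V \<Longrightarrow> b v - t * r v \<ge> 0"
        "card {v \<in> V. b v - t * r v > 0} < card {v \<in> V. b v > 0}"
        using linear_relation_shrink_support[OF V less.prems(1,2) r(1) _ r(3)] r(2,4)
        by simp blast
      have card_pos: "real (card {v \<in> V. b v > 0}) \<ge> 1" using t(4) by linarith
      show ?thesis
      proof (cases "t \<ge> 1")
        case True
        \<comment> \<open>Here \<open>r\<close> lies below the multiplicities of \<open>S\<close>,
          so by minimality \<open>S\<close> is itself the short relation \<open>r\<close>.\<close>
        have "r v \<le> count S v" if "v \<in> V" for v
        proof -
          have "real (r v) \<le> t * r v" using True mult_right_mono[of 1 t "real (r v)"] by simp
          also have "\<dots> \<le> b v" using t(3)[OF that] by simp
          also have "\<dots> \<le> real (count S v)" using less.prems(3)[OF that] .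
          finally show ?thesis by simp
        qed
        then have "r v = count S v" if "v \<in> V" for v
          using minimal_zero_sum_relation_unique[OF S, of r v\<^sub>0 v] r(1,3,4) that by (simp add: V_def)
        then have "(\<Sum>v\<in>V. b v) \<le> (\<Sum>v\<in>V. real (r v))"
          using less.prems(3) by (intro sum_mono) auto
        also have "\<dots> \<le> k" by (rule sum_r)
        also have "\<dots> \<le> card {v \<in> V. b v > 0} * k"
          using card_pos k mult_right_mono[of 1 _ k] by simp
        finally show ?thesis .
      next
        case False
        have le: "b v - t * r v \<le> real (count S v)" if "v \<in> V" for v
          using less.prems(3)[OF that] t(1) by (smt (verit) mult_nonneg_nonneg of_nat_0_le_iff)
        have "(\<Sum>v\<in>V. b v) = (\<Sum>v\<in>V. b v - t * r v) + t * (\<Sum>v\<in>V. real (r v))"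
          by (simp add: sum_subtractf sum_distrib_left)
        also have "\<dots> \<le> card {v \<in> V. b v - t * r v > 0} * k + 1 * k"
          using less.hyps[OF t(4,2,3) le] sum_r False t(1) k
          by (intro add_mono mult_mono) (auto intro: sum_nonneg)
        also have "\<dots> = (real (card {v \<in> V. b v - t * r v > 0}) + 1) * k"
          by (simp add: algebra_simps)
        also have "\<dots> \<le> card {v \<in> V. b v > 0} * k"
          using t(4) k by (intro mult_right_mono) auto
        finally show ?thesis .
      qed
    qed
  qed
  have "linear_relation V (\<lambda>v. real (count S v))"
    using S sum_mset_eq_0_iff_linear_relation[of V S] V
    by (simp add: V_def minimal_zero_sum_def)
  then have "real (size S) \<le> card {v \<in> V. real (count S v) > 0} * k"
    unfolding size by (intro main) auto
  also have "{v \<in> V. real (count S v) > 0} = V" by (auto simp: V_def)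
  finally show ?thesis by (simp add: k_def V_def power2_eq_square)
qed

section \<open>Short relations in rank at most 2\<close>

definition minor2 :: "'n \<Rightarrow> 'n \<Rightarrow> int ^ 'n \<Rightarrow> int ^ 'n \<Rightarrow> int" where
  "minor2 i j x y = x $ i * y $ j - x $ j * y $ i"

lemma minor2_bound:
  assumes "\<And>i. \<bar>real_of_int (x $ i)\<bar> \<le> m" "\<And>i. \<bar>real_of_int (y $ i)\<bar> \<le> m"
  shows "\<bar>real_of_int (minor2 i j x y)\<bar> \<le> 2 * m\<^sup>2"
proof -
  have "\<bar>real_of_int (x $ k)\<bar> * \<bar>real_of_int (y $ l)\<bar> \<le> m * m" for k l
    using assms by (intro mult_mono) (auto intro: order_trans[OF abs_ge_zero])
  then have "\<bar>real_of_int (x $ i) * real_of_int (y $ j)\<bar> \<le> m * m"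
    "\<bar>real_of_int (x $ j) * real_of_int (y $ i)\<bar> \<le> m * m" by (auto simp: abs_mult)
  then show ?thesis by (simp add: minor2_def power2_eq_square)
qed

lemma sum_supported_on_subset:
  fixes c :: "'a \<Rightarrow> int" and g :: "'a \<Rightarrow> int"
  assumes "finite V" "A \<subseteq> V" "\<And>v. v \<notin> A \<Longrightarrow> c v = 0"
    and "(\<Sum>v\<in>A. c v * g v) = 0"
  shows "(\<Sum>v\<in>V. real_of_int (c v) * real_of_int (g v)) = 0"
proof -
  have "(\<Sum>v\<in>V. real_of_int (c v) * real_of_int (g v))
      = (\<Sum>v\<in>A. real_of_int (c v) * real_of_int (g v))"
    using assms(1-3) by (intro sum.mono_neutral_right) auto
  also have "\<dots> = real_of_int (\<Sum>v\<in>A. c v * g v)" by simp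
  finally show ?thesis using assms(4) by simp
qed

text \<open>The hypothesis \<open>rank2\<close> says that the matrix with rows \<open>V\<close> has rank at most 2: the displayed
  expression is the \<open>3 \<times> 3\<close> minor with rows \<open>x, y, z\<close> and columns \<open>i, j, l\<close>.\<close>

lemma exists_short_relation_rank2:
  fixes V :: "(int ^ 'n) set"
  assumes "finite V" "m \<ge> 1" and bd: "\<And>v i. v \<in> V \<Longrightarrow> \<bar>real_of_int (v $ i)\<bar> \<le> m"
    and rank2: "\<And>x y z i j l. x \<in> V \<Longrightarrow> y \<in> V \<Longrightarrow> z \<in> V \<Longrightarrow>
      minor2 i j y z * x $ l + minor2 i j z x * y $ l + minor2 i j x y * z $ l = 0"
    and b: "linear_relation V b" "\<And>v. v \<in> V \<Longrightarrow> b v \<ge> 0" "\<exists>v\<in>V. b v \<noteq> 0"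
  shows "\<exists>c :: int ^ 'n \<Rightarrow> int. linear_relation V (\<lambda>v. real_of_int (c v))
        \<and> (\<forall>v\<in>V. b v = 0 \<longrightarrow> c v = 0) \<and> (\<exists>v\<in>V. c v \<noteq> 0)
        \<and> (\<forall>v\<in>V. \<bar>real_of_int (c v)\<bar> \<le> 2 * m\<^sup>2)"
proof -
  define J where "J = {v \<in> V. b v \<noteq> 0}"
  have JV: "J \<subseteq> V" and "finite J" using \<open>finite V\<close> by (auto simp: J_def)
  have m: "1 \<le> m\<^sup>2" "m \<le> m\<^sup>2" using \<open>m \<ge> 1\<close> by (auto simp: power2_eq_square mult_ge1_I)
  have rel_J: "(\<Sum>v\<in>J. b v * real_of_int (v $ i)) = 0" for i
  proof -
    have "(\<Sum>v\<in>V. b v * real_of_int (v $ i)) = (\<Sum>v\<in>J. b v * real_of_int (v $ i))"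
      using \<open>finite V\<close> by (intro sum.mono_neutral_right) (auto simp: J_def)
    then show ?thesis using b(1) by (simp add: linear_relation_def)
  qed
  have goalI: ?thesis if A: "A \<subseteq> J" "\<And>v. v \<notin> A \<Longrightarrow> c v = 0"
    "\<And>i. (\<Sum>v\<in>A. c v * v $ i) = 0" "\<exists>v\<in>A. c v \<noteq> 0" "\<And>v. v \<in> A \<Longrightarrow> \<bar>real_of_int (c v)\<bar> \<le> 2 * m\<^sup>2"
    for A and c :: "int ^ 'n \<Rightarrow> int"
  proof (intro exI[of _ c] conjI ballI impI)
    show "linear_relation V (\<lambda>v. real_of_int (c v))"
      unfolding linear_relation_def
      by (intro allI sum_supported_on_subset[where A = A]) (use A(1-3) JV \<open>finite V\<close> in auto)
    show "c v = 0" if "v \<in> V" "b v = 0" for v using A(1,2) that by (auto simp: J_def)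
    show "\<exists>v\<in>V. c v \<noteq> 0" using A(1,4) JV by blast
    show "\<bar>real_of_int (c v)\<bar> \<le> 2 * m\<^sup>2" if "v \<in> V" for v
      using A(2,5) by (cases "v \<in> A") auto
  qed
  \<comment> \<open>Inside the support \<open>J\<close> one of three relations is found: on the
    vector 0, on three vectors with \<open>2 \<times> 2\<close> minors as coefficients, or on two
    parallel vectors.\<close>
  show ?thesis
  proof (cases "0 \<in> J")
    case True
    then show ?thesis
      using m(1) by (intro goalI[of "{0}" "\<lambda>v. if v = 0 then 1 else 0"]) auto
  next
    case False
    obtain x where x: "x \<in> J" using b(3) by (auto simp: J_def)
    then obtain k where k: "x $ k \<noteq> 0" using False by (metis vec_eq_iff zero_index)
    show ?thesis
    proof (cases "\<exists>y\<in>J. \<exists>i j. minor2 i j x y \<noteq> 0")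
      case True
      then obtain y i j where y: "y \<in> J" "minor2 i j x y \<noteq> 0" by blast
      have xy: "x \<noteq> y" using y(2) by (auto simp: minor2_def)
      \<comment> \<open>The independent vectors \<open>x\<close> and \<open>y\<close> cannot carry
        \<open>b\<close> alone. So there is a third vector, and its coefficient
        \<open>minor2 i j x y\<close> makes the relation non-trivial.\<close>
      have "J \<noteq> {x, y}"
      proof
        assume "J = {x, y}"
        then have "b x * real_of_int (x $ l) + b y * real_of_int (y $ l) = 0" for l
          using rel_J[of l] xy by simp
        note this[of i] this[of j]
        then have "b y * real_of_int (minor2 i j x y) = 0"
          unfolding minor2_def of_int_diff of_int_mult by algebra
        then show False using y by (auto simp: J_def)
      qed
      then obtain z where z: "z \<in> J" "z \<noteq> x" "z \<noteq> y" using x y(1) by blast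
      have V3: "x \<in> V" "y \<in> V" "z \<in> V" using x y z JV by auto
      show ?thesis
        using x y z xy rank2[OF V3, of i j] minor2_bound[OF bd bd] V3
        by (intro goalI[of "{x, y, z}" "\<lambda>v. if v = x then minor2 i j y z else if v = y
              then minor2 i j z x else if v = z then minor2 i j x y else 0"])
          (auto simp: add.assoc)
    next
      case False
      then have par: "minor2 i j x y = 0" if "y \<in> J" for i j y using that by blast
      have "J \<noteq> {x}" using rel_J[of k] k x by (auto simp: J_def)
      then obtain y where y: "y \<in> J" "y \<noteq> x" using x by blast
      have "x $ i * y $ k - x $ k * y $ i = 0" for i using par[OF y(1), of i k]
        by (simp add: minor2_def)
      moreover have "\<bar>real_of_int (v $ k)\<bar> \<le> 2 * m\<^sup>2" if "v \<in> J" for v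
        using bd[of v k] that JV m by fastforce
      ultimately show ?thesis
        using x y k
        by (intro goalI[of "{x, y}" "\<lambda>v. if v = x then y $ k else if v = y then - (x $ k) else 0"])
          (auto simp: algebra_simps)
    qed
  qed
qed

lemma minimal_zero_sum_size_le_rank2:
  fixes S :: "(int ^ 'n) multiset"
  assumes "minimal_zero_sum S" "m \<ge> 1" "\<And>v i. v \<in># S \<Longrightarrow> \<bar>real_of_int (v $ i)\<bar> \<le> m"
    and "\<And>x y z i j l. x \<in># S \<Longrightarrow> y \<in># S \<Longrightarrow> z \<in># S \<Longrightarrow>
      minor2 i j y z * x $ l + minor2 i j z x * y $ l + minor2 i j x y * z $ l = 0"
  shows "real (size S) \<le> (real (card (set_mset S)))\<^sup>2 * (2 * m\<^sup>2)"
  by (intro minimal_zero_sum_size_le_short exists_short_nonneg_relation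
      exists_short_relation_rank2 assms) auto


section \<open>Determinants and the volume of a simplex in a ball\<close>

text \<open>The ring is left general: the integers serve for relations, the reals for
  volumes.\<close>

definition det3 :: "'a::comm_ring_1 ^ 3 \<Rightarrow> 'a ^ 3 \<Rightarrow> 'a ^ 3 \<Rightarrow> 'a" where
  "det3 x y z = det (vector [x, y, z])"

lemma det3_expand:
  "det3 x y z = x $ 1 * y $ 2 * z $ 3 + x $ 2 * y $ 3 * z $ 1 + x $ 3 * y $ 1 * z $ 2
    - x $ 1 * y $ 3 * z $ 2 - x $ 2 * y $ 1 * z $ 3 - x $ 3 * y $ 2 * z $ 1"
  by (simp add: det3_def det_3)

text \<open>Laplace expansion of a \<open>4 \<times> 4\<close> determinant in which the row of
  \<open>i\<close>-th coordinates occurs twice.\<close>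

lemma det3_relation:
  fixes x y z w :: "'a::comm_ring_1 ^ 3"
  shows "det3 y z w * x $ i - det3 x z w * y $ i + det3 x y w * z $ i - det3 x y z * w $ i = 0"
proof -
  have "\<forall>i. det3 y z w * x $ i - det3 x z w * y $ i + det3 x y w * z $ i - det3 x y z * w $ i = 0"
    unfolding forall_3 det3_expand by (simp add: algebra_simps)
  then show ?thesis by blast
qed

text \<open>Replace dw by -(ax + by + cz) in each determinant; determinants are multilinear and
  alternating. Hence, if \<open>det3 x y z\<close> is non-zero, all relations are
  proportional.\<close>

lemma cramer_relation:
  fixes x y z w :: "int ^ 3"
  assumes "\<And>i. a * x $ i + b * y $ i + c * z $ i + d * w $ i = 0"
  shows "d * det3 y z w = - (a * det3 x y z)" "d * det3 x z w = b * det3 x y z"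
    "d * det3 x y w = - (c * det3 x y z)"
proof -
  note eqs = assms[of 1] assms[of 2] assms[of 3]
  show "d * det3 y z w = - (a * det3 x y z)" unfolding det3_expand using eqs by algebra
  show "d * det3 x z w = b * det3 x y z" unfolding det3_expand using eqs by algebra
  show "d * det3 x y w = - (c * det3 x y z)" unfolding det3_expand using eqs by algebra
qed

text \<open>Hadamard's inequality, from Cauchy-Schwarz for the triple product and Lagrange's
  identity for \<open>cross3 y z\<close>.\<close>

lemma abs_det3_le:
  fixes x y z :: "real ^ 3"
  shows "\<bar>det3 x y z\<bar> \<le> norm x * norm y * norm z"
proof -
  have "(norm (cross3 y z))\<^sup>2 \<le> (norm y * norm z)\<^sup>2"
    using norm_cross_dot[of y z] zero_le_power2[of "y \<bullet> z"] by linarith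
  then have "norm (cross3 y z) \<le> norm y * norm z" by (rule power2_le_imp_le) simp
  then have "norm x * norm (cross3 y z) \<le> norm x * (norm y * norm z)"
    by (rule mult_left_mono) simp
  then show ?thesis
    using Cauchy_Schwarz_ineq2[of x "cross3 y z"]
    by (simp add: dot_cross_det det3_def mult.assoc)
qed

lemma prod3_le_cube:
  fixes p q r s :: real
  assumes "p \<ge> 0" "q \<ge> 0" "r \<ge> 0" "s \<ge> 0" "p\<^sup>2 + q\<^sup>2 + r\<^sup>2 \<le> 3 * s\<^sup>2"
  shows "p * q * r \<le> s ^ 3"
proof -
  have "(p + q + r)\<^sup>2 + (p - q)\<^sup>2 + (q - r)\<^sup>2 + (r - p)\<^sup>2 = 3 * (p\<^sup>2 + q\<^sup>2 + r\<^sup>2)"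
    by algebra
  then have "(p + q + r)\<^sup>2 \<le> 3 * (p\<^sup>2 + q\<^sup>2 + r\<^sup>2)"
    using zero_le_power2[of "p - q"] zero_le_power2[of "q - r"] zero_le_power2[of "r - p"]
    by linarith
  also have "\<dots> \<le> (3 * s)\<^sup>2" using assms(5) by (simp add: power_mult_distrib)
  finally have "(p + q + r)\<^sup>2 \<le> (3 * s)\<^sup>2" .
  then have "p + q + r \<le> 3 * s" by (rule power2_le_imp_le) (use assms in simp)
  then have *: "(p + q + r) ^ 3 \<le> (3 * s) ^ 3" by (rule power_mono) (use assms in simp)
  \<comment> \<open>The excess in AM-GM, written with non-negative multiples of squares.\<close>
  have "2 * ((p + q + r) ^ 3 - 27 * (p * q * r))
    = (p + q + r) * ((p - q)\<^sup>2 + (q - r)\<^sup>2 + (r - p)\<^sup>2)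
      + 6 * (p * (q - r)\<^sup>2 + q * (r - p)\<^sup>2 + r * (p - q)\<^sup>2)"
    by algebra
  also have "\<dots> \<ge> 0" using assms by simp
  finally show ?thesis using * by (simp add: power_mult_distrib)
qed

text \<open>The left-hand side is 6 times the volume of the simplex. The vectors \<open>P, Q, R\<close> below are
  twice the bimedians; for a regular simplex they are orthogonal and of equal length, so that
  both Hadamard's inequality and AM-GM are sharp.\<close>

lemma simplex_volume_le:
  fixes x y z w :: "real ^ 3"
  assumes "m \<ge> 0" "norm x \<le> m" "norm y \<le> m" "norm z \<le> m" "norm w \<le> m"
  shows "\<bar>det3 y z w - det3 x z w + det3 x y w - det3 x y z\<bar> \<le> 16 / (3 * sqrt 3) * m ^ 3"
proof -
  define P where "P = x + y - z - w"
  define Q where "Q = x + z - y - w"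
  define R where "R = x + w - y - z"
  define s where "s = 4 * m / sqrt 3"
  have sq: "(norm v)\<^sup>2 \<le> m\<^sup>2" if "norm v \<le> m" for v :: "real ^ 3"
    using that by (intro power_mono) auto
  \<comment> \<open>The four sign patterns are the rows of a Hadamard matrix of order 4, which
    multiplies sums of squares by 4. The term dropped next vanishes when the centroid is the
    origin.\<close>
  have "(norm P)\<^sup>2 + (norm Q)\<^sup>2 + (norm R)\<^sup>2 + (norm (x + y + z + w))\<^sup>2
      = 4 * ((norm x)\<^sup>2 + (norm y)\<^sup>2 + (norm z)\<^sup>2 + (norm w)\<^sup>2)"
    unfolding P_def Q_def R_def power2_norm_eq_inner by (simp add: algebra_simps inner_commute)
  then have "(norm P)\<^sup>2 + (norm Q)\<^sup>2 + (norm R)\<^sup>2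
      \<le> 4 * ((norm x)\<^sup>2 + (norm y)\<^sup>2 + (norm z)\<^sup>2 + (norm w)\<^sup>2)"
    using zero_le_power2[of "norm (x + y + z + w)"] by linarith
  also have "(norm x)\<^sup>2 + (norm y)\<^sup>2 + (norm z)\<^sup>2 + (norm w)\<^sup>2 \<le> m\<^sup>2 + m\<^sup>2 + m\<^sup>2 + m\<^sup>2"
    by (intro add_mono sq assms)
  also have "4 * (m\<^sup>2 + m\<^sup>2 + m\<^sup>2 + m\<^sup>2) = 16 * m\<^sup>2" by simp
  also have "\<dots> = 3 * s\<^sup>2" by (simp add: s_def power_divide power_mult_distrib)
  finally have "norm P * norm Q * norm R \<le> s ^ 3"
    using \<open>m \<ge> 0\<close> by (intro prod3_le_cube) (auto simp: s_def)
  then have "\<bar>det3 P Q R\<bar> \<le> s ^ 3" using abs_det3_le[of P Q R] by linarith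
  moreover have "det3 P Q R = -4 * (det3 y z w - det3 x z w + det3 x y w - det3 x y z)"
    unfolding det3_expand P_def Q_def R_def vector_add_component vector_minus_component by algebra
  moreover have "s ^ 3 = 4 * (16 / (3 * sqrt 3) * m ^ 3)"
    by (simp add: s_def power_divide power_mult_distrib power3_eq_cube)
  ultimately show ?thesis by (simp add: abs_mult)
qed

section \<open>Upper bound for the length\<close>

lemma minimal_zero_sum_size_le_rank3:
  fixes S :: "(int ^ 3) multiset"
  assumes S: "minimal_zero_sum S" and card: "card (set_mset S) = 4" and "m \<ge> 0"
    and ball: "set_mset S \<subseteq> int_ball3 m"
    and xyz: "x \<in># S" "y \<in># S" "z \<in># S" "det3 x y z \<noteq> 0"
  shows "real (size S) \<le> 16 / (3 * sqrt 3) * m ^ 3"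
proof -
  have neq: "x \<noteq> y" "x \<noteq> z" "y \<noteq> z" using xyz(4) by (auto simp: det3_expand)
  then have "card (set_mset S - {x, y, z}) = 1" using card xyz by (simp add: card_Diff_subset)
  then obtain w where w: "set_mset S - {x, y, z} = {w}" by (rule card_1_singletonE)
  then have V: "set_mset S = {x, y, z, w}" and neq_w: "x \<noteq> w" "y \<noteq> w" "z \<noteq> w" using xyz by auto
  define a b c d where abcd: "a = int (count S x)" "b = int (count S y)" "c = int (count S z)"
    "d = int (count S w)"
  have pos: "a > 0" "b > 0" "c > 0" "d > 0" using V by (auto simp: abcd)
  have rel: "a * x $ i + b * y $ i + c * z $ i + d * w $ i = 0" for i
    using sum_mset_component[of "set_mset S" S i] S V neq neq_w
    by (simp add: minimal_zero_sum_def abcd add.assoc)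
  \<comment> \<open>The sign makes \<open>D\<close> positive; proportionality then makes
    \<open>A\<close>, \<open>B\<close>, \<open>C\<close> positive.\<close>
  define \<sigma> where "\<sigma> = - sgn (det3 x y z)"
  define A B C D where ABCD: "A = \<sigma> * det3 y z w" "B = - (\<sigma> * det3 x z w)" "C = \<sigma> * det3 x y w"
    "D = - (\<sigma> * det3 x y z)"
  have D: "D > 0" using xyz(4) by (simp add: ABCD \<sigma>_def sgn_if)
  have ratio: "d * A = a * D" "d * B = b * D" "d * C = c * D"
    using cramer_relation[OF rel] by (simp_all add: ABCD algebra_simps)
  have rel': "A * x $ i + B * y $ i + C * z $ i + D * w $ i = 0" for i
    using arg_cong[OF det3_relation[of y z w x i], of "\<lambda>t. \<sigma> * t"] by (simp add: ABCD algebra_simps)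
  have pos': "A > 0" "B > 0" "C > 0"
    using ratio pos D by (metis mult_pos_pos zero_less_mult_pos)+
  \<comment> \<open>If \<open>D < d\<close>, proportionality puts all four determinants below the
    multiplicities, and they give a proper non-empty zero-sum subsequence.\<close>
  have "d \<le> D"
  proof (rule ccontr)
    assume "\<not> d \<le> D"
    then have "d * A \<le> d * a" "d * B \<le> d * b" "d * C \<le> d * c"
      unfolding ratio using pos by (simp_all add: mult.commute)
    then have le: "A \<le> a" "B \<le> b" "C \<le> c" using pos by simp_all
    define r where "r v = nat (if v = x then A else if v = y then B else if v = z then C else D)" for v
    have "linear_relation (set_mset S) (\<lambda>v. real (r v))"
    proof -
      have "A * x $ i + (B * y $ i + (C * z $ i + D * w $ i)) = 0" for i
        using rel'[of i] by (simp add: add.assoc)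
      then have "real_of_int (A * x $ i + (B * y $ i + (C * z $ i + D * w $ i))) = 0" for i
        by simp
      then show ?thesis
        using neq neq_w pos' D unfolding linear_relation_def V r_def by simp
    qed
    moreover have "r v \<le> count S v" if "v \<in># S" for v
      using that le \<open>\<not> d \<le> D\<close> unfolding V r_def abcd by auto
    moreover have "r w > 0" "w \<in># S" using neq_w D V by (auto simp: r_def)
    ultimately have "r w = count S w"
      using minimal_zero_sum_relation_unique[OF S] by blast
    then show False using \<open>\<not> d \<le> D\<close> neq_w D by (simp add: r_def abcd)
  qed
  then have "d * a \<le> d * A" "d * b \<le> d * B" "d * c \<le> d * C"
    unfolding ratio using pos by (simp_all add: mult.commute)
  then have le: "a \<le> A" "b \<le> B" "c \<le> C" using pos by simp_all
  define \<rho> :: "int ^ 3 \<Rightarrow> real ^ 3" where "\<rho> v = (\<chi> i. real_of_int (v $ i))" for v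
  have \<rho>: "det3 (\<rho> u) (\<rho> v) (\<rho> t) = real_of_int (det3 u v t)" for u v t
    by (simp add: det3_expand \<rho>_def)
  have norm: "norm (\<rho> v) \<le> m" if "v \<in># S" for v
  proof (rule power2_le_imp_le)
    show "(norm (\<rho> v))\<^sup>2 \<le> m\<^sup>2"
      using that ball unfolding power2_norm_eq_inner
      by (auto simp: int_ball3_def \<rho>_def inner_vec_def sum_3 power2_eq_square)
  qed fact
  have "int (size S) = a + b + c + d"
    using neq neq_w by (simp add: size_multiset_overloaded_eq V abcd)
  also have "\<dots> \<le> A + B + C + D" using le \<open>d \<le> D\<close> by simp
  also have "\<dots> = \<sigma> * (det3 y z w - det3 x z w + det3 x y w - det3 x y z)"
    by (simp add: ABCD algebra_simps)
  also have "\<dots> \<le> \<bar>det3 y z w - det3 x z w + det3 x y w - det3 x y z\<bar>"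
    by (auto simp: \<sigma>_def sgn_if)
  finally have "real (size S) \<le> real_of_int \<bar>det3 y z w - det3 x z w + det3 x y w - det3 x y z\<bar>"
    by linarith
  also have "\<dots> = \<bar>det3 (\<rho> y) (\<rho> z) (\<rho> w) - det3 (\<rho> x) (\<rho> z) (\<rho> w)
      + det3 (\<rho> x) (\<rho> y) (\<rho> w) - det3 (\<rho> x) (\<rho> y) (\<rho> z)\<bar>" by (simp add: \<rho>)
  also have "\<dots> \<le> 16 / (3 * sqrt 3) * m ^ 3"
    using norm V by (intro simplex_volume_le \<open>m \<ge> 0\<close>) auto
  finally show ?thesis .
qed

text \<open>In rank at most 2 the length is at most \<open>32 * m\<^sup>2\<close>, and
  \<open>m \<ge> 12\<close> lets the cubic bound absorb this.\<close>

lemma minimal_zero_sum_size_le: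
  fixes S :: "(int ^ 3) multiset"
  assumes S: "minimal_zero_sum S" and card: "card (set_mset S) = 4"
    and ball: "set_mset S \<subseteq> int_ball3 m" and m: "m \<ge> 12"
  shows "real (size S) \<le> 16 / (3 * sqrt 3) * m ^ 3"
proof (cases "\<exists>x\<in>#S. \<exists>y\<in>#S. \<exists>z\<in>#S. det3 x y z \<noteq> 0")
  case True
  then show ?thesis using minimal_zero_sum_size_le_rank3[OF S card _ ball] m by auto
next
  case False
  have "real (size S) \<le> (real (card (set_mset S)))\<^sup>2 * (2 * m\<^sup>2)"
  proof (rule minimal_zero_sum_size_le_rank2[OF S])
    show "\<bar>real_of_int (v $ i)\<bar> \<le> m" if "v \<in># S" for v i
    proof -
      have "real_of_int ((v $ 1)\<^sup>2 + (v $ 2)\<^sup>2 + (v $ 3)\<^sup>2) \<le> m\<^sup>2"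
        using that ball by (auto simp: int_ball3_def)
      moreover have "\<forall>i. (v $ i)\<^sup>2 \<le> (v $ 1)\<^sup>2 + (v $ 2)\<^sup>2 + (v $ 3)\<^sup>2"
        unfolding forall_3 by simp
      ultimately have "(real_of_int (v $ i))\<^sup>2 \<le> m\<^sup>2"
        by (metis of_int_le_iff of_int_power order_trans)
      then show ?thesis using m abs_le_square_iff[of "real_of_int (v $ i)" m] by simp
    qed
    show "minor2 i j y z * x $ l + minor2 i j z x * y $ l + minor2 i j x y * z $ l = 0"
      if "x \<in># S" "y \<in># S" "z \<in># S" for x y z and i j l :: 3
    proof -
      have "det3 x y z = 0" using False that by blast
      \<comment> \<open>Each expression is 0 if a column repeats and \<open>det3 x y z\<close> up to
        sign otherwise.\<close>
      then have "\<forall>i j l. minor2 i j y z * x $ l + minor2 i j z x * y $ l + minor2 i j x y * z $ l = 0"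
        unfolding forall_3 minor2_def det3_expand by (auto simp: algebra_simps)
      then show ?thesis by blast
    qed
  qed (use m in simp)
  also have "\<dots> = 32 * m\<^sup>2" by (simp add: card)
  also have "\<dots> \<le> 16 / (3 * sqrt 3) * m ^ 3"
  proof -
    have "sqrt 3 \<le> 2" by (rule real_le_lsqrt) auto
    then have "32 * (3 * sqrt 3) \<le> 16 * m" using m by linarith
    then have "32 \<le> 16 / (3 * sqrt 3) * m" by (simp add: field_simps)
    then have "32 * m\<^sup>2 \<le> 16 / (3 * sqrt 3) * m * m\<^sup>2" by (rule mult_right_mono) simp
    then show ?thesis by (simp add: power3_eq_cube power2_eq_square)
  qed
  finally show ?thesis .
qed

section \<open>Long sequences near a regular simplex\<close>

text \<open>The vectors perturb the vertices \<open>n(1,1,1)\<close>, \<open>n(-1,-1,1)\<close>, \<open>n(1,-1,-1)\<close>, \<open>n(-1,1,-1)\<close>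
  of a regular simplex so that two of the four \<open>3 \<times> 3\<close> determinants, \<open>q\<close> and \<open>q + 1\<close>, are coprime;
  hence the determinants generate all integer relations.\<close>

lemma exists_long_minimal_zero_sum:
  fixes n :: int
  assumes n: "n \<ge> 1" and ball: "3 * (real_of_int (n + 1))\<^sup>2 \<le> m\<^sup>2"
  obtains S :: "(int ^ 3) multiset" where "set_mset S \<subseteq> int_ball3 m" "card (set_mset S) = 4"
    "minimal_zero_sum S" "int (size S) = 16 * n ^ 3 - 4 * n\<^sup>2 - 2 * n + 1"
proof -
  define x y z w :: "int ^ 3" where xyzw: "x = vector [n + 1, n, n]"
    "y = vector [- n, - n, n - 1]" "z = vector [n, 1 - n, - n]" "w = vector [- n, n, - n]"
  \<comment> \<open>With \<open>q + 1\<close>, these are the absolute values of the four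
    determinants. The signs agree in \<open>det3_relation\<close>, so they can serve as
    multiplicities.\<close>
  define p s q where psq: "p = 4 * n ^ 3 - 2 * n\<^sup>2 + n" "s = 4 * n ^ 3 + 2 * n\<^sup>2 - n"
    "q = 4 * n ^ 3 - 2 * n\<^sup>2 - n"
  have "n * 1 \<le> n * n" "n\<^sup>2 * 1 \<le> n\<^sup>2 * n" using n by (intro mult_left_mono; simp)+
  then have "n \<le> n\<^sup>2" "n\<^sup>2 \<le> n ^ 3" by (simp_all add: power2_eq_square power3_eq_cube)
  then have pos: "p > 0" "s > 0" "q > 0" using n by (simp_all add: psq)
  have neq: "x \<noteq> y" "x \<noteq> z" "x \<noteq> w" "y \<noteq> z" "y \<noteq> w" "z \<noteq> w"
    using n unfolding xyzw vec_eq_iff forall_3 by auto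
  define S where "S = replicate_mset (nat p) x + replicate_mset (nat s) y
    + replicate_mset (nat q) z + replicate_mset (nat (q + 1)) w"
  have set_S: "set_mset S = {x, y, z, w}" using pos by (auto simp: S_def)
  have count_S: "count S x = nat p" "count S y = nat s" "count S z = nat q" "count S w = nat (q + 1)"
    using neq by (simp_all add: S_def)
  have comp: "sum_mset T $ i = int (count T x) * x $ i + int (count T y) * y $ i
      + int (count T z) * z $ i + int (count T w) * w $ i" if "set_mset T \<subseteq> {x, y, z, w}" for T i
    using sum_mset_component[OF _ that, of i] neq by (simp add: add.assoc)
  have "\<forall>i. sum_mset S $ i = 0"
    unfolding forall_3 using comp[of S] pos
    by (simp add: set_S count_S) (simp add: xyzw psq algebra_simps power2_eq_square power3_eq_cube)
  then have zero: "sum_mset S = 0" by (simp add: vec_eq_iff)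
  have "T = {#} \<or> T = S" if T: "T \<subseteq># S" "sum_mset T = 0" for T
  proof -
    have set_T: "set_mset T \<subseteq> {x, y, z, w}" using set_mset_mono[OF T(1)] set_S by simp
    define a b c d where abcd: "a = int (count T x)" "b = int (count T y)" "c = int (count T z)"
      "d = int (count T w)"
    have rel: "a * x $ i + b * y $ i + c * z $ i + d * w $ i = 0" for i
      using comp[OF set_T, of i] T(2) by (simp add: abcd)
    have dets: "det3 y z w = - p" "det3 x z w = s" "det3 x y w = - q" "det3 x y z = q + 1"
      unfolding det3_expand xyzw psq by (simp_all add: algebra_simps power2_eq_square power3_eq_cube)
    have ratio: "d * p = a * (q + 1)" "d * s = b * (q + 1)" "d * q = c * (q + 1)"
      using cramer_relation[OF rel] by (simp_all add: dets)
    \<comment> \<open>Coprimality made explicit: \<open>d * q = c * (q + 1)\<close> gives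
      \<open>d = (d - c) * (q + 1)\<close>.\<close>
    define k where "k = d - c"
    have d: "d = k * (q + 1)" using ratio(3) by (simp add: k_def algebra_simps)
    have "(q + 1) * a = (q + 1) * (k * p)" "(q + 1) * b = (q + 1) * (k * s)"
      "(q + 1) * c = (q + 1) * (k * q)" using ratio by (simp_all add: d algebra_simps)
    then have abc: "a = k * p" "b = k * s" "c = k * q" using pos by simp_all
    \<comment> \<open>As \<open>w\<close> occurs \<open>q + 1\<close> times in \<open>S\<close>,
      \<open>k\<close> is 0 or 1, so \<open>T\<close> is empty or all of \<open>S\<close>.\<close>
    have "count T w \<le> count S w" using T(1) by (simp add: mset_subset_eq_count)
    then have "0 \<le> d" "d \<le> q + 1" using pos by (simp_all add: abcd count_S)
    then have "0 \<le> k * (q + 1)" "k * (q + 1) \<le> 1 * (q + 1)" by (simp_all add: d)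
    then have "0 \<le> k" "k \<le> 1" using pos by (simp_all add: zero_le_mult_iff)
    then consider "k = 0" | "k = 1" by linarith
    then show ?thesis
    proof cases
      case 1
      then have "count T v = 0" for v
        using abc d set_T by (cases "v \<in># T") (auto simp: abcd not_in_iff)
      then show ?thesis by (simp add: multiset_eq_iff)
    next
      case 2
      then have "count T v = count S v" if "v \<in> {x, y, z, w}" for v
        using abc d that pos by (auto simp: abcd count_S)
      moreover have "count T v = count S v" if "v \<notin> {x, y, z, w}" for v
        using that set_T set_S by (metis count_inI subsetD)
      ultimately show ?thesis by (metis multiset_eqI)
    qed
  qed
  then have min: "minimal_zero_sum S"
    using zero unfolding minimal_zero_sum_def by (metis subset_mset.less_le)
  have "v \<in> int_ball3 m" if "v \<in> {x, y, z, w}" for v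
  proof -
    have "(v $ 1)\<^sup>2 + (v $ 2)\<^sup>2 + (v $ 3)\<^sup>2 \<le> 3 * (n + 1)\<^sup>2"
      using that n by (auto simp: xyzw power2_eq_square algebra_simps)
    then have "real_of_int ((v $ 1)\<^sup>2 + (v $ 2)\<^sup>2 + (v $ 3)\<^sup>2) \<le> real_of_int (3 * (n + 1)\<^sup>2)"
      by (simp only: of_int_le_iff)
    also have "\<dots> \<le> m\<^sup>2" using ball by simp
    finally show ?thesis by (simp add: int_ball3_def)
  qed
  moreover have "card (set_mset S) = 4" using neq by (simp add: set_S)
  moreover have "int (size S) = 16 * n ^ 3 - 4 * n\<^sup>2 - 2 * n + 1"
    using pos by (simp add: S_def) (simp add: psq)
  ultimately show ?thesis using that[of S] min set_S by blast
qed

section \<open>Two-sided bounds and the limit\<close>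

lemma davenport_supp_bounds:
  assumes m: "m \<ge> 12"
  shows "16 * (m / sqrt 3 - 3) ^ 3 \<le> real (davenport_supp 4 (int_ball3 m))"
    and "real (davenport_supp 4 (int_ball3 m)) \<le> 16 / (3 * sqrt 3) * m ^ 3"
proof -
  define L where "L = {size S |S. set_mset S \<subseteq> int_ball3 m \<and> card (set_mset S) = 4
    \<and> minimal_zero_sum S}"
  have D: "davenport_supp 4 (int_ball3 m) = Max L" by (simp add: davenport_supp_def L_def)
  have up: "real l \<le> 16 / (3 * sqrt 3) * m ^ 3" if "l \<in> L" for l
    using that minimal_zero_sum_size_le[OF _ _ _ m] by (auto simp: L_def)
  \<comment> \<open>Finiteness here and \<open>SL\<close> below ensure that \<open>Max L\<close> is
    a genuine maximum.\<close>
  have fin: "finite L"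
  proof (rule finite_subset)
    show "L \<subseteq> {..nat \<lfloor>16 / (3 * sqrt 3) * m ^ 3\<rfloor>}" using up by (auto intro!: le_nat_floor)
  qed simp
  \<comment> \<open>The largest \<open>n\<close> for which the perturbed simplex satisfies the
    radius condition \<open>3 * (real_of_int (n + 1))\<^sup>2 \<le> m\<^sup>2\<close>.\<close>
  define n where "n = \<lfloor>m / sqrt 3\<rfloor> - 1"
  have "sqrt 3 \<le> 2" by (rule real_le_lsqrt) auto
  then have "6 * sqrt 3 \<le> m" using m by linarith
  then have m6: "m / sqrt 3 \<ge> 6" by (simp add: field_simps)
  have n: "real_of_int (n + 1) \<le> m / sqrt 3" "real_of_int (n - 1) \<ge> m / sqrt 3 - 3"
    unfolding n_def by linarith+
  then have "n \<ge> 1" using m6 by linarith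
  then have "(real_of_int (n + 1))\<^sup>2 \<le> (m / sqrt 3)\<^sup>2" using n by (intro power_mono) auto
  then have "3 * (real_of_int (n + 1))\<^sup>2 \<le> m\<^sup>2" by (simp add: power_divide)
  then obtain S :: "(int ^ 3) multiset" where S: "set_mset S \<subseteq> int_ball3 m"
    "card (set_mset S) = 4" "minimal_zero_sum S" "int (size S) = 16 * n ^ 3 - 4 * n\<^sup>2 - 2 * n + 1"
    using exists_long_minimal_zero_sum[OF \<open>n \<ge> 1\<close>] by blast
  have SL: "size S \<in> L" using S by (auto simp: L_def)
  then show "real (davenport_supp 4 (int_ball3 m)) \<le> 16 / (3 * sqrt 3) * m ^ 3"
    unfolding D using fin by (intro up Max_in) auto
  \<comment> \<open>The shift by 3 absorbs both the rounding of \<open>m / sqrt 3\<close> and the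
    lower-order terms of the length.\<close>
  have "16 * (m / sqrt 3 - 3) ^ 3 \<le> 16 * real_of_int (n - 1) ^ 3"
    using n m6 by (intro mult_left_mono power_mono) auto
  also have "\<dots> = real_of_int (16 * (n - 1) ^ 3)" by simp
  also have "\<dots> \<le> real_of_int (int (size S))"
  proof -
    have "2 * n - 1 \<le> n\<^sup>2"
      using zero_le_power2[of "n - 1"] by (simp add: power2_eq_square algebra_simps)
    moreover have "16 * (n - 1) ^ 3 = 16 * n ^ 3 - 48 * n\<^sup>2 + 48 * n - 16" by algebra
    ultimately have "16 * (n - 1) ^ 3 \<le> int (size S)"
      unfolding S(4) using \<open>n \<ge> 1\<close> by linarith
    then show ?thesis by (simp only: of_int_le_iff)
  qed
  also have "\<dots> \<le> real (davenport_supp 4 (int_ball3 m))"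
    unfolding D using fin SL by simp
  finally show "16 * (m / sqrt 3 - 3) ^ 3 \<le> real (davenport_supp 4 (int_ball3 m))" .
qed

theorem theorem7:
  "(\<lambda>m::real. real (davenport_supp 4 (int_ball3 m))) \<sim>[at_top]
     (\<lambda>m. 16 / (3 * sqrt 3) * m ^ 3)"
proof (rule asymp_equivI')
  let ?g = "\<lambda>m::real. 16 / (3 * sqrt 3) * m ^ 3"
  let ?D = "\<lambda>m::real. real (davenport_supp 4 (int_ball3 m))"
  show "((\<lambda>m. ?D m / ?g m) \<longlongrightarrow> 1) at_top"
  proof (rule tendsto_sandwich)
    show "eventually (\<lambda>m. 16 * (m / sqrt 3 - 3) ^ 3 / ?g m \<le> ?D m / ?g m) at_top"
      using eventually_ge_at_top[of 12]
      by eventually_elim (intro divide_right_mono davenport_supp_bounds, auto)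
    show "eventually (\<lambda>m. ?D m / ?g m \<le> 1) at_top"
      using eventually_ge_at_top[of 12]
    proof eventually_elim
      case (elim m)
      have "?g m > 0" using elim by simp
      then show ?case using davenport_supp_bounds(2)[OF elim] by (subst divide_le_eq_1_pos) auto
    qed
    \<comment> \<open>The cube of \<open>sqrt 3\<close> is \<open>3 * sqrt 3\<close>, so the
      constants cancel. At \<open>m = 0\<close> both sides are 0, as division by 0 gives 0.\<close>
    have "16 * (m / sqrt 3 - 3) ^ 3 / ?g m = ((m - 3 * sqrt 3) / m) ^ 3" for m
    proof -
      have "m / sqrt 3 - 3 = (m - 3 * sqrt 3) / sqrt 3" by (simp add: diff_divide_distrib)
      then show ?thesis by (simp add: power_divide power3_eq_cube)
    qed
    moreover have "((\<lambda>m. ((m - 3 * sqrt 3) / m) ^ 3) \<longlongrightarrow> 1) at_top" by real_asymp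
    ultimately show "((\<lambda>m. 16 * (m / sqrt 3 - 3) ^ 3 / ?g m) \<longlongrightarrow> 1) at_top" by simp
  qed simp
qed

end
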